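(* Let $q, m \geq 2$ be integers with $\gcd(m, q-1) = 1$. Let $p(x) \in \mathbb{Z}[x]$ be a polynomial of degree $h \geq 3$ with $p(\mathbb{N}) \subset \mathbb{N}$. Then there exist constants $C = C(q,m,p) > 0$ and $N_0 = N_0(q,m,p) \geq 1$ such that for all $g \in \mathbb{Z}$ and all integers $N \geq N_0$, $$\#\{0 \leq n < N : \ s_q(p(n)) \equiv g \bmod m\} \geq C\, N^{4/(3h+1)}.$$ Moreover, for monomials $p(x) = x^h$ with $h \geq 3$, one can take $$N_0 = q^{3(2h+m)}\left(2hq^2(6q)^h\right)^{3h+1}, \qquad C = \left(16\, h\, q^5\, (6q)^h \cdot q^{(24h+12m)/(3h+1)}\right)^{-1}.$$
   Context: For an integer $q \geq 2$ and a nonnegative integer $n$, $s_q(n)$ denotes the sum of the digits of $n$ in its base-$q$ expansion. $\mathbb{N}$ denotes the set of nonnegative integers. *)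

theory Defs
  imports Complex_Main "HOL-Computational_Algebra.Polynomial" "HOL-Number_Theory.Cong"
begin

(* The digit of n at position i in base q is (n div q^i) mod q. Only the finitely many
   positions with q^i \<le> n can carry a nonzero digit; the sum is meaningful for q \<ge> 2. *)
definition digit_sum :: "nat \<Rightarrow> nat \<Rightarrow> nat" where
  "digit_sum q n = (\<Sum>i | q ^ i \<le> n. (n div q ^ i) mod q)"

(* The coercion nat truncates negative values, so this counts what it should only
   for p that is nonnegative on the natural numbers. *)
definition digit_sum_count :: "nat \<Rightarrow> nat \<Rightarrow> int poly \<Rightarrow> int \<Rightarrow> nat \<Rightarrow> nat" where
  "digit_sum_count q m p g N =
     card {n::nat. n < N \<and> [int (digit_sum q (nat (poly p (int n)))) = g] (mod int m)}"

end

theory Submission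
  imports Defs
begin

text \<open>
  Consider the cubic \<open>t(x) = A x\<^sup>3 + B x\<^sup>2 - a x + D\<close> with positive coefficients and \<open>a\<close> small
  compared with \<open>A\<close>, \<open>B\<close>, \<open>D\<close>. In every power of \<open>t\<close> the linear coefficient is the only negative
  one. If \<open>r\<close> has nonnegative coefficients (a translate of \<open>p\<close> does), the same holds for \<open>r(t(x))\<close>,
  so for large \<open>k\<close> the base-\<open>q\<close> expansion of \<open>r(t(q\<^sup>k))\<close> is a concatenation of blocks independent of
  \<open>k\<close>, except that the borrow at the linear coefficient makes the digit sum \<open>w + (q - 1) k\<close>. As
  \<open>q - 1\<close> is coprime to \<open>m\<close>, one of \<open>m\<close> consecutive values of \<open>k\<close> hits the residue class of \<open>g\<close>.
  With \<open>A\<close>, \<open>B\<close>, \<open>D\<close> in \<open>[q\<^sup>u\<^sup>-\<^sup>1, q\<^sup>u)\<close> and \<open>a\<close> up to a constant times \<open>q\<^sup>u\<close>, this gives of the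
  order of \<open>q\<^sup>4\<^sup>u\<close> distinct arguments \<open>n = t(q\<^sup>k)\<close>, where \<open>k \<approx> h u\<close> and hence
  \<open>n \<le> N \<approx> q\<close> to the power \<open>(3h + 1) u\<close>.
\<close>

section \<open>Base-q digit sums: recursion, concatenation and complement\<close>

lemma digit_sum_eq_sum_lessThan:
  assumes "q \<ge> 2" "n < q ^ k"
  shows "digit_sum q n = (\<Sum>i<k. n div q ^ i mod q)"
  unfolding digit_sum_def
proof (rule sum.mono_neutral_left)
  show "{i. q ^ i \<le> n} \<subseteq> {..<k}"
  proof
    fix i assume "i \<in> {i. q ^ i \<le> n}"
    hence "q ^ i \<le> n" by simp
    hence "q ^ i < q ^ k" using assms(2) by (rule le_less_trans)
    moreover have "1 < q" using assms by simp
    ultimately show "i \<in> {..<k}" using power_less_imp_less_exp by blast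
  qed
qed auto

lemma digit_sum_rec:
  assumes "q \<ge> 2"
  shows "digit_sum q n = n mod q + digit_sum q (n div q)"
proof -
  \<comment> \<open>Since n < q^n, a window of n digits (or n + 1) contains the whole expansion, so
    both digit sums can be taken over an explicit range.\<close>
  have "n < 2 ^ n" by (rule less_exp)
  also have "(2::nat) ^ n \<le> q ^ n" using assms by (intro power_mono) auto
  finally have n: "n < q ^ n" .
  hence n': "n < q ^ Suc n" using assms by (simp add: trans_less_add1 less_le_trans)
  have d: "n div q < q ^ n" using n by (meson div_le_dividend le_less_trans)
  show ?thesis
    unfolding digit_sum_eq_sum_lessThan[OF assms n'] digit_sum_eq_sum_lessThan[OF assms d]
    by (subst sum.lessThan_Suc_shift) (simp add: div_mult2_eq)
qed

lemma digit_sum_0: "q \<ge> 2 \<Longrightarrow> digit_sum q 0 = 0"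
  by (simp add: digit_sum_def)

lemma digit_sum_append:
  assumes "q \<ge> 2" "a < q ^ k"
  shows "digit_sum q (a + q ^ k * b) = digit_sum q a + digit_sum q b"
  using assms(2)
proof (induction k arbitrary: a)
  case 0
  then show ?case using assms by (simp add: digit_sum_0)
next
  case (Suc k)
  have "a div q < q ^ k" using Suc.prems assms(1) by (simp add: less_mult_imp_div_less mult.commute)
  moreover have "(a + q ^ Suc k * b) div q = a div q + q ^ k * b"
    using assms(1) by (simp add: mult.assoc)
  moreover have "(a + q ^ Suc k * b) mod q = a mod q"
    by (simp add: mult.assoc)
  ultimately show ?case
    using Suc.IH[of "a div q"] digit_sum_rec[OF assms(1), of "a + q ^ Suc k * b"]
      digit_sum_rec[OF assms(1), of a] by simp
qed

text \<open>Subtracting c from the number with k digits q - 1 needs no borrow: each digit d of c,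
  leading zeros included, becomes q - 1 - d. Each of the k positions thus contributes q - 1 to the
  two sums together.\<close>

lemma digit_sum_complement:
  assumes "q \<ge> 2" "c < q ^ k"
  shows "digit_sum q (q ^ k - 1 - c) + digit_sum q c = (q - 1) * k"
  using assms(2)
proof (induction k arbitrary: c)
  case 0
  then show ?case using assms by (simp add: digit_sum_0)
next
  case (Suc k)
  have d: "c div q < q ^ k" using Suc.prems assms(1) by (simp add: less_mult_imp_div_less mult.commute)
  have r: "c mod q < q" using assms(1) by simp
  \<comment> \<open>The splitting into last digit and remaining digits is computed over the
    integers, where subtraction is not truncated.\<close>
  have "int (q ^ Suc k - 1 - c) = int q ^ Suc k - 1 - int c"
    using Suc.prems by (simp add: of_nat_diff)
  also have "\<dots> = int q ^ Suc k - 1 - (int q * int (c div q) + int (c mod q))"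
    by (metis mult_div_mod_eq of_nat_add of_nat_mult)
  also have "\<dots> = int ((q - 1 - c mod q) + q * (q ^ k - 1 - c div q))"
  proof -
    have X: "int (q ^ k - 1 - c div q) = int q ^ k - 1 - int (c div q)"
      using d by (simp add: of_nat_diff)
    have Y: "int (q - 1 - c mod q) = int q - 1 - int (c mod q)"
      using r by (simp add: of_nat_diff)
    show ?thesis unfolding of_nat_add of_nat_mult X Y by (simp add: algebra_simps)
  qed
  finally have e: "q ^ Suc k - 1 - c = (q - 1 - c mod q) + q * (q ^ k - 1 - c div q)"
    by (rule of_nat_eq_iff[THEN iffD1])
  have lt: "q - 1 - c mod q < q" using assms(1) by simp
  have e1: "(q ^ Suc k - 1 - c) mod q = q - 1 - c mod q"
    unfolding e using lt by simp
  have e2: "(q ^ Suc k - 1 - c) div q = q ^ k - 1 - c div q"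
    unfolding e using lt by simp
  have "digit_sum q (q ^ Suc k - 1 - c) + digit_sum q c =
      (q - 1 - c mod q) + c mod q + (digit_sum q (q ^ k - 1 - c div q) + digit_sum q (c div q))"
    using digit_sum_rec[OF assms(1), of "q ^ Suc k - 1 - c"]
      digit_sum_rec[OF assms(1), of c] unfolding e1 e2 by simp
  also have "\<dots> = (q - 1) + (q - 1) * k"
    using Suc.IH[OF d] r by simp
  finally show ?case by simp
qed

lemma digit_sum_append_int:
  fixes a b :: int
  assumes "q \<ge> 2" "0 \<le> a" "a < int q ^ k" "0 \<le> b"
  shows "digit_sum q (nat (a + int q ^ k * b)) = digit_sum q (nat a) + digit_sum q (nat b)"
proof -
  have "nat (a + int q ^ k * b) = nat a + q ^ k * nat b"
    using assms by (simp add: nat_add_distrib nat_mult_distrib nat_power_eq)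
  moreover have "nat a < q ^ k"
    using assms by (simp add: nat_less_iff)
  ultimately show ?thesis using digit_sum_append assms(1) by simp
qed

section \<open>Digit sums of polynomial values at powers of q\<close>

lemma poly_nonneg_coeffs:
  fixes R :: "int poly"
  assumes "\<And>i. coeff R i \<ge> 0" "x \<ge> 0"
  shows "poly R x \<ge> 0"
  unfolding poly_altdef using assms by (intro sum_nonneg mult_nonneg_nonneg) auto

text \<open>Coefficients below q^k occupy disjoint blocks of k digits in the expansion of R(q^k).
  The digit sum is therefore the sum of the digit sums of the coefficients, and a larger k only adds
  zeros.\<close>

lemma digit_sum_poly_nonneg_coeffs:
  fixes R :: "int poly"
  assumes "q \<ge> 2" "\<And>i. coeff R i \<ge> 0"
  shows "\<exists>w. \<forall>k. (\<forall>i. coeff R i < int q ^ k) \<longrightarrow> digit_sum q (nat (poly R (int q ^ k))) = w"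
  using assms(2)
proof (induction R)
  case 0
  then show ?case by auto
next
  case (pCons a R)
  have a: "a \<ge> 0" using pCons.prems[of 0] by simp
  have R: "coeff R i \<ge> 0" for i using pCons.prems[of "Suc i"] by simp
  obtain w where w: "\<And>k. (\<forall>i. coeff R i < int q ^ k) \<Longrightarrow>
      digit_sum q (nat (poly R (int q ^ k))) = w"
    using pCons.IH R by blast
  show ?case
  proof (intro exI allI impI)
    fix k assume k: "\<forall>i. coeff (pCons a R) i < int q ^ k"
    have "a < int q ^ k" using k[rule_format, of 0] by simp
    moreover have "\<forall>i. coeff R i < int q ^ k"
    proof
      fix i show "coeff R i < int q ^ k" using k[rule_format, of "Suc i"] by simp
    qed
    ultimately show "digit_sum q (nat (poly (pCons a R) (int q ^ k))) = digit_sum q (nat a) + w"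
      using digit_sum_append_int[OF assms(1) a, of k "poly R (int q ^ k)"] w
        poly_nonneg_coeffs[of R "int q ^ k", OF R] by simp
  qed
qed

text \<open>The borrow caused by the negative linear coefficient \<open>c\<close> produces the block
  \<open>q\<^sup>k - \<bar>c\<bar>\<close>, whose leading digits are all \<open>q - 1\<close>.\<close>

lemma digit_sum_poly_neg_linear_coeff:
  fixes R :: "int poly"
  assumes q: "q \<ge> 2"
    and neg: "coeff R 1 < 0" and pos2: "coeff R 2 > 0" and pos: "\<And>i. i \<noteq> 1 \<Longrightarrow> coeff R i \<ge> 0"
  shows "\<exists>w. \<forall>k. (\<forall>i. \<bar>coeff R i\<bar> < int q ^ k) \<longrightarrow>
    int (digit_sum q (nat (poly R (int q ^ k)))) = w + int (q - 1) * int k"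
proof -
  obtain c0 R1 where R1: "R = pCons c0 R1" by (cases R)
  obtain c1 R2 where R2: "R1 = pCons c1 R2" by (cases R1)
  \<comment> \<open>This carries out the borrow: one unit of the quadratic coefficient becomes q^k
    in the linear position. By \<open>pos2\<close>, what remains still has nonnegative
    coefficients.\<close>
  define R3 where "R3 = R2 - 1"
  have R: "R = pCons c0 (pCons c1 R2)" using R1 R2 by simp
  have R3nn: "coeff R3 i \<ge> 0" for i
    using pos2 pos[of "Suc (Suc i)"] by (cases i) (auto simp: R R3_def numeral_2_eq_2)
  have c0: "c0 \<ge> 0" using pos[of 0] by (simp add: R)
  have c1: "c1 < 0" using neg by (simp add: R)
  obtain w where w: "\<And>k. (\<forall>i. coeff R3 i < int q ^ k) \<Longrightarrow>
      digit_sum q (nat (poly R3 (int q ^ k))) = w"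
    using digit_sum_poly_nonneg_coeffs[OF q R3nn] by blast
  show ?thesis
  proof (intro exI allI impI)
    fix k assume k: "\<forall>i. \<bar>coeff R i\<bar> < int q ^ k"
    have k0: "c0 < int q ^ k" using k[rule_format, of 0] by (simp add: R)
    have k1: "- c1 < int q ^ k" using k[rule_format, of 1] c1 by (simp add: R)
    have k3: "coeff R3 i < int q ^ k" for i
      using k[rule_format, of "Suc (Suc i)"] by (cases i) (auto simp: R R3_def)
    define z where "z = int q ^ k"
    have nn: "poly R3 z \<ge> 0" unfolding z_def using poly_nonneg_coeffs R3nn by simp
    have "poly R z = c0 + z * ((c1 + z) + z * poly R3 z)"
      by (simp add: R R3_def algebra_simps)
    hence "digit_sum q (nat (poly R z)) = digit_sum q (nat c0) + digit_sum q (nat ((c1 + z) + z * poly R3 z))"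
      using digit_sum_append_int[OF q c0 k0, of "(c1 + z) + z * poly R3 z"] nn k1 z_def by simp
    also have "digit_sum q (nat ((c1 + z) + z * poly R3 z)) = digit_sum q (nat (c1 + z)) + w"
      using digit_sum_append_int[OF q, of "c1 + z" k "poly R3 z"] nn k1 c1 w k3 z_def by simp
    finally have s: "digit_sum q (nat (poly R z)) = digit_sum q (nat c0) + (digit_sum q (nat (c1 + z)) + w)" .
    have z': "q ^ k = nat z" by (simp add: z_def nat_power_eq)
    \<comment> \<open>Writing q^k - |c1| as the complement of |c1| - 1 makes its digit sum (q - 1)k
      minus a quantity that does not depend on k.\<close>
    have zz: "nat (c1 + z) = q ^ k - 1 - nat (- c1 - 1)"
      using c1 k1 unfolding z' z_def[symmetric] by (simp add: nat_diff_distrib' flip: nat_1) 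
    have "digit_sum q (nat (c1 + z)) + digit_sum q (nat (- c1 - 1)) = (q - 1) * k"
      unfolding zz using digit_sum_complement[OF q, of "nat (- c1 - 1)" k] c1 k1
      unfolding z' z_def[symmetric] by simp
    hence "int (digit_sum q (nat (c1 + z))) = int (q - 1) * int k - int (digit_sum q (nat (- c1 - 1)))"
      by (metis add_diff_cancel_right' of_nat_add of_nat_mult)
    thus "int (digit_sum q (nat (poly R (int q ^ k)))) =
        (int (digit_sum q (nat c0)) + int w - int (digit_sum q (nat (- c1 - 1)))) + int (q - 1) * int k"
      using s unfolding z_def[symmetric] by simp
  qed
qed

section \<open>Translates with nonnegative coefficients\<close>

text \<open>By induction on a + x p(x): its translate is a + (x + e) p(x + e), in which only the
  constant coefficient can suffer from a negative a. That coefficient is a + e p(e), which is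
  positive once p(e) >= 1 and e > |a|; this is why positivity at e is carried through the
  induction.\<close>

lemma shifted_poly_nonneg_coeffs:
  fixes p :: "int poly"
  assumes "lead_coeff p > 0"
  shows "\<exists>e0. \<forall>e::nat. e \<ge> e0 \<longrightarrow>
    (\<forall>i. coeff (p \<circ>\<^sub>p [:int e, 1:]) i \<ge> 0) \<and> poly p (int e) > 0"
  using assms
proof (induction p)
  case 0
  then show ?case by simp
next
  case (pCons a p)
  show ?case
  proof (cases "p = 0")
    case True
    then show ?thesis using pCons.prems by (auto simp: pcompose_pCons coeff_pCons split: nat.splits)
  next
    case False
    with pCons obtain e0 where e0: "\<And>e. e \<ge> e0 \<Longrightarrow>
        (\<forall>i. coeff (p \<circ>\<^sub>p [:int e, 1:]) i \<ge> 0) \<and> poly p (int e) > 0" by auto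
    show ?thesis
    proof (intro exI allI impI)
      fix e assume e: "e \<ge> max e0 (nat \<bar>a\<bar> + 1)"
      define r where "r = p \<circ>\<^sub>p [:int e, 1:]"
      have r: "coeff r i \<ge> 0" for i using e0 e by (simp add: r_def)
      have pe: "poly p (int e) \<ge> 1" using e0[of e] e by simp
      have "int e * 1 \<le> int e * poly p (int e)" using pe by (intro mult_left_mono) auto
      moreover have "int e > \<bar>a\<bar>" using e by linarith
      ultimately have P: "poly (pCons a p) (int e) > 0" by simp
      have r0: "coeff r 0 = poly p (int e)"
        by (simp add: r_def)
      have "coeff (pCons a p \<circ>\<^sub>p [:int e, 1:]) i \<ge> 0" for i
      proof (cases i)
        case 0
        then show ?thesis using P by (simp add: pcompose_pCons r0 flip: r_def)
      next
        case (Suc j)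
        then show ?thesis using r by (simp add: pcompose_pCons flip: r_def)
      qed
      with P show "(\<forall>i. coeff (pCons a p \<circ>\<^sub>p [:int e, 1:]) i \<ge> 0) \<and> poly (pCons a p) (int e) > 0"
        by blast
    qed
  qed
qed

section \<open>Coefficients of powers of the cubic\<close>

lemma abs_coeff_cubic_mult_le:
  fixes A B C D K :: int and f :: "int poly"
  assumes "\<And>i. \<bar>coeff f i\<bar> \<le> K"
  shows "\<bar>coeff ([:D, C, B, A:] * f) i\<bar> \<le> (\<bar>D\<bar> + \<bar>C\<bar> + \<bar>B\<bar> + \<bar>A\<bar>) * K"
proof -
  have K: "0 \<le> K" using assms[of 0] by simp
  have b: "\<bar>x * coeff (pCons 0 f) i\<bar> \<le> \<bar>x\<bar> * K"
    "\<bar>x * coeff (pCons 0 (pCons 0 f)) i\<bar> \<le> \<bar>x\<bar> * K"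
    "\<bar>x * coeff (pCons 0 (pCons 0 (pCons 0 f))) i\<bar> \<le> \<bar>x\<bar> * K"
    "\<bar>x * coeff f i\<bar> \<le> \<bar>x\<bar> * K" for x i
    using assms K by (auto simp: abs_mult coeff_pCons split: nat.split intro!: mult_left_mono)
  have "coeff ([:D, C, B, A:] * f) i = D * coeff f i + C * coeff (pCons 0 f) i
      + B * coeff (pCons 0 (pCons 0 f)) i + A * coeff (pCons 0 (pCons 0 (pCons 0 f))) i"
    by (auto simp: coeff_pCons split: nat.split)
  then show ?thesis
    using b(4)[of D i] b(1)[of C i] b(2)[of B i] b(3)[of A i] unfolding distrib_right by linarith
qed

lemma abs_coeff_cubic_power_le:
  fixes A B C D Q :: int
  assumes "\<bar>A\<bar> \<le> Q" "\<bar>B\<bar> \<le> Q" "\<bar>C\<bar> \<le> Q" "\<bar>D\<bar> \<le> Q"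
  shows "\<bar>coeff ([:D, C, B, A:] ^ l) i\<bar> \<le> (4 * Q) ^ l"
proof (induction l arbitrary: i)
  case 0
  then show ?case by (simp add: coeff_1)
next
  case (Suc l)
  have "\<bar>coeff ([:D, C, B, A:] ^ Suc l) i\<bar> \<le> (\<bar>D\<bar> + \<bar>C\<bar> + \<bar>B\<bar> + \<bar>A\<bar>) * (4 * Q) ^ l"
    unfolding power_Suc using Suc.IH by (rule abs_coeff_cubic_mult_le)
  also have "\<dots> \<le> (4 * Q) * (4 * Q) ^ l"
    using assms by (intro mult_right_mono) auto
  finally show ?case by simp
qed

text \<open>Measures the effect of the term -ax. With T and P the cubics with and without it,
  T^(n+1) - P^(n+1) = T (T^n - P^n) + (T - P) P^n, and T - P = -ax supplies a factor a instead of Q.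
  Hence the difference is small when a is small compared with Q.\<close>

lemma abs_coeff_cubic_power_diff_le:
  fixes A B D Q a :: int
  assumes "\<bar>A\<bar> \<le> Q" "\<bar>B\<bar> \<le> Q" "\<bar>D\<bar> \<le> Q" "0 \<le> a" "a \<le> Q"
  shows "\<bar>coeff ([:D, -a, B, A:] ^ Suc l - [:D, 0, B, A:] ^ Suc l) i\<bar> \<le> (1 + int l) * a * (4 * Q) ^ l"
proof (induction l arbitrary: i)
  case 0
  then show ?case using assms by (auto simp: coeff_pCons split: nat.split)
next
  case (Suc l)
  let ?T = "[:D, -a, B, A:]" and ?P = "[:D, 0, B, A:]"
  have "?T ^ Suc (Suc l) - ?P ^ Suc (Suc l) = ?T * (?T ^ Suc l - ?P ^ Suc l) + (?T - ?P) * ?P ^ Suc l"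
    by (simp only: power_Suc[of _ "Suc l"] algebra_simps)
  also have "?T - ?P = [:0, -a, 0, 0:]" by simp
  finally have "coeff (?T ^ Suc (Suc l) - ?P ^ Suc (Suc l)) i =
      coeff (?T * (?T ^ Suc l - ?P ^ Suc l)) i + coeff ([:0, -a, 0, 0:] * ?P ^ Suc l) i"
    by (simp only: coeff_add)
  also have "\<bar>\<dots>\<bar> \<le> \<bar>coeff (?T * (?T ^ Suc l - ?P ^ Suc l)) i\<bar> + \<bar>coeff ([:0, -a, 0, 0:] * ?P ^ Suc l) i\<bar>"
    by (rule abs_triangle_ineq)
  also have "\<dots> \<le> (4 * Q) * ((1 + int l) * a * (4 * Q) ^ l) + a * (4 * Q) ^ Suc l"
  proof (rule add_mono)
    have "\<bar>coeff (?T * (?T ^ Suc l - ?P ^ Suc l)) i\<bar>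
        \<le> (\<bar>D\<bar> + \<bar>-a\<bar> + \<bar>B\<bar> + \<bar>A\<bar>) * ((1 + int l) * a * (4 * Q) ^ l)"
      by (rule abs_coeff_cubic_mult_le) (rule Suc.IH)
    also have "\<dots> \<le> (4 * Q) * ((1 + int l) * a * (4 * Q) ^ l)"
      using assms by (intro mult_right_mono) auto
    finally show "\<bar>coeff (?T * (?T ^ Suc l - ?P ^ Suc l)) i\<bar> \<le> \<dots>" .
    have "\<bar>coeff ([:0, -a, 0, 0:] * ?P ^ Suc l) i\<bar> \<le> (\<bar>0\<bar> + \<bar>-a\<bar> + \<bar>0\<bar> + \<bar>0\<bar>) * (4 * Q) ^ Suc l"
      by (rule abs_coeff_cubic_mult_le, rule abs_coeff_cubic_power_le) (use assms in auto)
    then show "\<bar>coeff ([:0, -a, 0, 0:] * ?P ^ Suc l) i\<bar> \<le> a * (4 * Q) ^ Suc l"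
      using assms by simp
  qed
  also have "\<dots> = (1 + int (Suc l)) * a * (4 * Q) ^ Suc l" by (simp add: algebra_simps)
  finally show ?case .
qed

text \<open>Every exponent \<open>i \<le> 3l\<close> except \<open>1\<close> is a sum of \<open>l\<close> numbers from \<open>{0, 2, 3}\<close>.\<close>

lemma coeff_nonneg_cubic_power_ge:
  fixes A B D M :: int
  assumes "0 \<le> M" "M \<le> A" "M \<le> B" "M \<le> D" "i \<le> 3 * l" "i \<noteq> 1"
  shows "coeff ([:D, 0, B, A:] ^ l) i \<ge> M ^ l"
  using assms(5,6)
proof (induction l arbitrary: i)
  case 0
  then show ?case by simp
next
  case (Suc l)
  define f where "f = [:D, 0, B, A:] ^ l"
  have nn: "coeff f i \<ge> 0" for i
  proof -
    have "coeff ([:D, 0, B, A:] ^ l) i \<ge> 0" for l i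
    proof (induction l arbitrary: i)
      case (Suc l)
      then show ?case using assms(1-4) by (auto simp: coeff_pCons split: nat.split)
    qed (simp add: coeff_1)
    then show ?thesis by (simp add: f_def)
  qed
  have nn': "coeff (pCons 0 f) i \<ge> 0" "coeff (pCons 0 (pCons 0 f)) i \<ge> 0"
    "coeff (pCons 0 (pCons 0 (pCons 0 f))) i \<ge> 0" for i
    using nn by (auto simp: coeff_pCons split: nat.split)
  have IH: "coeff f j \<ge> M ^ l" if "j \<le> 3 * l" "j \<noteq> 1" for j
    using Suc.IH that by (simp add: f_def)
  have step: "x * y \<ge> M ^ Suc l" if "x \<ge> M" "y \<ge> M ^ l" for x y
    using mult_mono[OF that] that assms(1) by simp
  let ?a = "D * coeff f i" and ?b = "B * coeff (pCons 0 (pCons 0 f)) i"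
    and ?c = "A * coeff (pCons 0 (pCons 0 (pCons 0 f))) i"
  have eq: "coeff ([:D, 0, B, A:] ^ Suc l) i = ?a + ?b + ?c"
    unfolding power_Suc f_def[symmetric] by (auto simp: coeff_pCons split: nat.split)
  have nonneg: "?a \<ge> 0" "?b \<ge> 0" "?c \<ge> 0"
    using assms(1-4) nn nn' by auto
  \<comment> \<open>One factor is split off: its constant term serves i <= 3l, its quadratic term i
    = 3l + 1 and i = 3l + 2, its cubic term i = 3l + 3. The exponent left for the other l factors is
    never 1.\<close>
  consider "i \<le> 3 * l" | "i = 2 + (i - 2)" "i - 2 \<le> 3 * l" "i - 2 \<noteq> 1" | "i = 3 + 3 * l"
  proof -
    have "i \<le> 3 * l \<or> (i = 2 + (i - 2) \<and> i - 2 \<le> 3 * l \<and> i - 2 \<noteq> 1) \<or> i = 3 + 3 * l"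
      using Suc.prems by presburger
    then show ?thesis using that by blast
  qed
  then have "?a \<ge> M ^ Suc l \<or> ?b \<ge> M ^ Suc l \<or> ?c \<ge> M ^ Suc l"
  proof cases
    case 1
    then show ?thesis using step[OF assms(4) IH] Suc.prems by blast
  next
    case 2
    then have "coeff (pCons 0 (pCons 0 f)) i = coeff f (i - 2)"
      by (metis add_2_eq_Suc coeff_pCons_Suc)
    then show ?thesis using step[OF assms(3) IH] 2 by metis
  next
    case 3
    then have "coeff (pCons 0 (pCons 0 (pCons 0 f))) i = coeff f (3 * l)"
      by (simp add: numeral_3_eq_3)
    moreover have "3 * l \<noteq> 1" by presburger
    ultimately show ?thesis using step[OF assms(2) IH[of "3 * l"]] by simp
  qed
  then show ?case using eq nonneg by linarith
qed

text \<open>Exactly one of the factors contributes its linear term and the others contribute D, so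
  for D > 0 the sign is that of C.\<close>

lemma coeff_1_cubic_power:
  fixes A B C D :: int
  shows "coeff ([:D, C, B, A:] ^ Suc l) 1 = (1 + int l) * C * D ^ l"
proof (induction l)
  case 0
  then show ?case by simp
next
  case (Suc l)
  have "coeff ([:D, C, B, A:] ^ Suc (Suc l)) 1 =
      D * coeff ([:D, C, B, A:] ^ Suc l) 1 + C * coeff ([:D, C, B, A:] ^ Suc l) 0"
    unfolding power_Suc[of _ "Suc l"] by simp
  also have "coeff ([:D, C, B, A:] ^ Suc l) 0 = D ^ Suc l"
    by (simp only: coeff_0_power) simp
  finally show ?case using Suc by (simp add: algebra_simps)
qed

lemma degree_cubic_power_le: "degree ([:D, C, B, A:] ^ l :: int poly) \<le> 3 * l"
  by (rule order_trans[OF degree_power_le]) simp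

text \<open>Without the linear term the coefficient is at least M^l. Restoring -ax changes it by at
  most l a (4qM)^(l-1), and this is less than M^l because \<open>small\<close> bounds a by M / (h
  (6q)^h) while l (4q)^(l-1) < h (6q)^h.\<close>

lemma cubic_power_coeff_pos:
  fixes A B D M q a :: int
  assumes "M \<le> A" "A \<le> q * M" "M \<le> B" "B \<le> q * M" "M \<le> D" "D \<le> q * M" "1 \<le> q" "1 \<le> a"
    and small: "a * (int h * (6 * q) ^ h) \<le> M" and l: "1 \<le> l" "l \<le> h" and i: "i \<le> 3 * l" "i \<noteq> 1"
  shows "coeff ([:D, -a, B, A:] ^ l) i > 0"
proof -
  obtain k where k: "l = Suc k" using l by (cases l) auto
  have h: "1 \<le> int h * (6 * q) ^ h"
  proof -
    have "(1::int) * 1 \<le> int h * (6 * q) ^ h"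
      using l assms(7) by (intro mult_mono one_le_power) auto
    then show ?thesis by simp
  qed
  have "a * 1 \<le> a * (int h * (6 * q) ^ h)" using h assms(8) by (intro mult_left_mono) auto
  with small have aM: "a \<le> M" by simp
  hence M: "M \<ge> 1" using assms(8) by simp
  have MQ: "M * 1 \<le> M * q" using M assms(7) by (intro mult_left_mono) auto
  hence aQ: "a \<le> q * M" using aM by (simp add: mult.commute)
  have "(1 + int k) * (4 * q) ^ k < int h * (6 * q) ^ h"
  proof -
    have "(4 * q) ^ k \<le> (6 * q) ^ k" using assms(7) by (intro power_mono) auto
    also have "\<dots> < (6 * q) ^ h" using assms(7) k l by (intro power_strict_increasing) auto
    finally have "int h * (4 * q) ^ k < int h * (6 * q) ^ h" using l by simp
    moreover have "(1 + int k) * (4 * q) ^ k \<le> int h * (4 * q) ^ k"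
      using k l assms(7) by (intro mult_right_mono) auto
    ultimately show ?thesis by linarith
  qed
  hence "a * ((1 + int k) * (4 * q) ^ k) < a * (int h * (6 * q) ^ h)"
    using assms(8) by simp
  hence "a * ((1 + int k) * (4 * q) ^ k) < M" using small by linarith
  hence "a * ((1 + int k) * (4 * q) ^ k) * M ^ k < M * M ^ k" using M by simp
  hence "(1 + int k) * a * (4 * (q * M)) ^ k < M ^ l"
    by (simp add: k power_mult_distrib mult_ac)
  moreover have "\<bar>coeff ([:D, -a, B, A:] ^ l - [:D, 0, B, A:] ^ l) i\<bar> \<le> (1 + int k) * a * (4 * (q * M)) ^ k"
    unfolding k using assms M aQ by (intro abs_coeff_cubic_power_diff_le) auto
  moreover have "coeff ([:D, 0, B, A:] ^ l) i \<ge> M ^ l"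
    using assms M i by (intro coeff_nonneg_cubic_power_ge) auto
  ultimately show ?thesis unfolding coeff_diff by linarith
qed

section \<open>Composition with the cubic\<close>

lemma coeff_pcompose_eq_sum:
  fixes r t :: "'a::comm_semiring_1 poly"
  shows "coeff (r \<circ>\<^sub>p t) i = (\<Sum>l\<le>degree r. coeff r l * coeff (t ^ l) i)"
proof -
  have "degree (map_poly (\<lambda>x. [:x:]) r) = degree r"
    by (rule degree_map_poly) simp
  then have "r \<circ>\<^sub>p t = (\<Sum>l\<le>degree r. smult (coeff r l) (t ^ l))"
    by (simp add: pcompose_altdef poly_altdef coeff_map_poly)
  then show ?thesis by (simp add: coeff_sum)
qed

text \<open>The composition of r with the cubic inherits the sign pattern of the powers, so the
  borrow argument applies as soon as q^k exceeds all its coefficients. The bound on k is the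
  exponent of q in an upper bound for them.\<close>

lemma digit_sum_poly_cubic:
  fixes A B D M a :: int and r :: "int poly"
  defines "h \<equiv> degree r"
  assumes q: "q \<ge> 2" and h: "h \<ge> 1" and r: "\<And>i. coeff r i \<ge> 0"
    and s: "(\<Sum>l\<le>h. coeff r l) \<le> int q ^ s" and Mu: "int q * M = int q ^ u"
    and A: "M \<le> A" "A \<le> int q * M" and B: "M \<le> B" "B \<le> int q * M" and D: "M \<le> D" "D \<le> int q * M"
    and a: "1 \<le> a" "a * (int h * (6 * int q) ^ h) \<le> M"
  shows "\<exists>w. \<forall>k > h * u + 2 * h + s.
    int (digit_sum q (nat (poly r (poly [:D, -a, B, A:] (int q ^ k))))) = w + int (q - 1) * int k"
proof -
  let ?T = "[:D, -a, B, A:]"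
  define R where "R = r \<circ>\<^sub>p ?T"
  have q1: "1 \<le> int q" using q by simp
  have Q: "int q ^ u \<ge> 1" using q1 by simp
  then have "int q * M > 0" unfolding Mu by linarith
  then have M: "M > 0" using q1 by (simp add: zero_less_mult_iff)
  have coeff_R: "coeff R i = (\<Sum>l\<le>h. coeff r l * coeff (?T ^ l) i)" for i
    unfolding R_def h_def by (rule coeff_pcompose_eq_sum)
  have "r \<noteq> 0" using h unfolding h_def by auto
  then have lead: "coeff r h > 0" using r[of h] by (simp add: h_def less_le)
  have Tpos: "coeff (?T ^ l) i > 0" if "1 \<le> l" "l \<le> h" "i \<le> 3 * l" "i \<noteq> 1" for l i
    using cubic_power_coeff_pos[OF A B D q1 a that] .
  have Tnn: "coeff (?T ^ l) i \<ge> 0" if "l \<le> h" "i \<noteq> 1" for l i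
  proof (cases "l = 0 \<or> i > 3 * l")
    case True
    then show ?thesis using coeff_eq_0[of "?T ^ l" i] degree_cubic_power_le[of D "-a" B A l]
      by (auto simp: coeff_1)
  next
    case False
    then show ?thesis using Tpos[of l i] that by simp
  qed
  have Tneg: "coeff (?T ^ l) 1 \<le> 0" "l \<ge> 1 \<Longrightarrow> coeff (?T ^ l) 1 < 0" for l
  proof -
    have "(1 + int k) * a * D ^ k > 0" for k using D M a by (intro mult_pos_pos) auto
    then have "coeff (?T ^ Suc k) 1 < 0" for k unfolding coeff_1_cubic_power by simp
    then show "l \<ge> 1 \<Longrightarrow> coeff (?T ^ l) 1 < 0" for l by (cases l) auto
    then show "coeff (?T ^ l) 1 \<le> 0" by (cases "l = 0") (auto simp: less_imp_le)
  qed
  have nonneg: "coeff R i \<ge> 0" if "i \<noteq> 1" for i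
    unfolding coeff_R using r Tnn that by (intro sum_nonneg mult_nonneg_nonneg) auto
  \<comment> \<open>The summand l = h alone makes the quadratic coefficient strictly positive and,
    below, the linear one strictly negative; the other summands have the same weak sign.\<close>
  have "0 < coeff r h * coeff (?T ^ h) 2"
    using lead h Tpos[of h 2] by (intro mult_pos_pos) auto
  also have "\<dots> \<le> coeff R 2"
    unfolding coeff_R using r Tnn by (intro member_le_sum) auto
  finally have pos2: "coeff R 2 > 0" .
  have "0 < coeff r h * (- coeff (?T ^ h) 1)"
    using lead h Tneg(2)[of h] by (intro mult_pos_pos) auto
  also have "\<dots> \<le> (\<Sum>l\<le>h. coeff r l * (- coeff (?T ^ l) 1))"
    using r Tneg(1) by (intro member_le_sum[of h _ "\<lambda>l. coeff r l * (- coeff (?T ^ l) 1)"] mult_nonneg_nonneg) auto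
  also have "\<dots> = - coeff R 1"
    unfolding coeff_R by (simp add: sum_negf)
  finally have neg: "coeff R 1 < 0" by simp
  have "a * 1 \<le> a * (int h * (6 * int q) ^ h)"
  proof (rule mult_left_mono)
    have "(1::int) * 1 \<le> int h * (6 * int q) ^ h"
      using h q1 by (intro mult_mono one_le_power) auto
    then show "1 \<le> int h * (6 * int q) ^ h" by simp
  qed (use a in auto)
  then have "a \<le> M" using a(2) by linarith
  also have "M \<le> int q ^ u"
    using M q1 mult_right_mono[of 1 "int q" M] unfolding Mu[symmetric] by simp
  finally have aQ: "a \<le> int q ^ u" .
  have Tbound: "\<bar>coeff (?T ^ l) i\<bar> \<le> (4 * int q ^ u) ^ h" if "l \<le> h" for l i
  proof -
    have "\<bar>coeff (?T ^ l) i\<bar> \<le> (4 * int q ^ u) ^ l"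
      using A B D M a aQ unfolding Mu by (intro abs_coeff_cubic_power_le) auto
    also have "\<dots> \<le> (4 * int q ^ u) ^ h"
      using that Q by (intro power_increasing) auto
    finally show ?thesis .
  qed
  have bound: "\<bar>coeff R i\<bar> < int q ^ k" if "k > h * u + 2 * h + s" for i k
  proof -
    have "\<bar>coeff R i\<bar> \<le> (\<Sum>l\<le>h. \<bar>coeff r l * coeff (?T ^ l) i\<bar>)"
      unfolding coeff_R by (rule sum_abs)
    also have "\<dots> \<le> (\<Sum>l\<le>h. coeff r l * (4 * int q ^ u) ^ h)"
      using r Tbound by (intro sum_mono) (auto simp: abs_mult intro!: mult_left_mono)
    also have "\<dots> = (\<Sum>l\<le>h. coeff r l) * (4 * int q ^ u) ^ h"
      by (simp add: sum_distrib_right)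
    \<comment> \<open>Replacing 4 by q^2 turns the bound into a pure power of q; this is the origin
      of the summand 2h in the bound on k.\<close>
    also have "\<dots> \<le> int q ^ s * (int q ^ 2 * int q ^ u) ^ h"
    proof (intro mult_mono s power_mono)
      have "(2::int) ^ 2 \<le> int q ^ 2" using q by (intro power_mono) auto
      then show "4 \<le> int q ^ 2" by simp
    qed (use Q in auto)
    also have "\<dots> = int q ^ (h * u + 2 * h + s)"
      by (simp add: power_add power_mult power_mult_distrib mult_ac flip: power_mult[of _ _ h])
    also have "\<dots> < int q ^ k" using that q by (intro power_strict_increasing) auto
    finally show ?thesis .
  qed
  show ?thesis
    using digit_sum_poly_neg_linear_coeff[OF q neg pos2 nonneg] bound
    unfolding R_def poly_pcompose by meson
qed

section \<open>Counting the values of the cubics\<close>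

lemma exists_cong_arith_progression:
  fixes q m :: nat and w g :: int
  assumes "m \<ge> 1" "coprime m (q - 1)"
  shows "\<exists>j\<in>{1..m}. [w + int (q - 1) * int (b + j) = g] (mod int m)"
proof -
  obtain x where x: "[int (q - 1) * x = 1] (mod int m)"
    using cong_solve_coprime_int[of "int (q - 1)" "int m"] assms(2)
    by (auto simp: coprime_commute)
  \<comment> \<open>With x the inverse of q - 1 modulo m, y solves b + 1 + y = x (g - w). Reducing y
    modulo m and adding 1 puts j into {1..m}, so that b + j lies strictly beyond b.\<close>
  define y where "y = x * (g - w) - int b - 1"
  define j where "j = nat (y mod int m) + 1"
  have ym: "0 \<le> y mod int m" "y mod int m < int m" using assms(1) by simp_all
  then have "j \<in> {1..m}" by (simp add: j_def nat_less_iff Suc_le_eq)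
  moreover have "[w + int (q - 1) * int (b + j) = g] (mod int m)"
  proof -
    have "int (b + j) = int b + 1 + y mod int m" using ym by (simp add: j_def)
    also have "[\<dots> = int b + 1 + y] (mod int m)" by (intro cong_add) (auto simp: cong_def)
    also have "int b + 1 + y = x * (g - w)" by (simp add: y_def)
    finally have "[w + int (q - 1) * int (b + j) = w + int (q - 1) * (x * (g - w))] (mod int m)"
      by (intro cong_add cong_mult cong_refl)
    also have "w + int (q - 1) * (x * (g - w)) = w + int (q - 1) * x * (g - w)" by simp
    also have "[\<dots> = w + 1 * (g - w)] (mod int m)"
      by (intro cong_add cong_mult cong_refl x)
    finally show ?thesis by simp
  qed
  ultimately show ?thesis by blast
qed

text \<open>The leading term decides the size. From below, B z^2 >= z^2 pays for a z; from above, A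
  <= Q - 1 leaves a spare z^3 that covers B z^2, and D < z <= a z.\<close>

lemma cubic_bounds:
  fixes A B D M Q a z :: int
  assumes "M \<le> A" "A < Q" "1 \<le> B" "B < Q" "0 \<le> D" "D < Q" "1 \<le> a" "a \<le> z" "Q \<le> z"
  shows "M * z ^ 3 \<le> poly [:D, -a, B, A:] z" "poly [:D, -a, B, A:] z < Q * z ^ 3"
proof -
  have z: "z \<ge> 1" using assms by simp
  have eq: "poly [:D, -a, B, A:] z = A * z ^ 3 + B * z ^ 2 - a * z + D"
    by (simp add: power2_eq_square power3_eq_cube algebra_simps)
  have "M * z ^ 3 \<le> A * z ^ 3" using assms z by (intro mult_right_mono) auto
  moreover have "a * z \<le> z * z" using assms z by (intro mult_right_mono) auto
  moreover have "1 * z ^ 2 \<le> B * z ^ 2" using assms by (intro mult_right_mono) auto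
  ultimately show "M * z ^ 3 \<le> poly [:D, -a, B, A:] z"
    unfolding eq using assms by (simp only: power2_eq_square mult_1)
  have "A * z ^ 3 \<le> (Q - 1) * z ^ 3" using assms z by (intro mult_right_mono) auto
  moreover have "B * z ^ 2 \<le> z * z ^ 2" using assms by (intro mult_right_mono) auto
  moreover have "1 * z \<le> a * z" using assms z by (intro mult_right_mono) auto
  moreover have "z * z ^ 2 = z ^ 3" by (simp add: power2_eq_square power3_eq_cube)
  moreover have "(Q - 1) * z ^ 3 = Q * z ^ 3 - z ^ 3" by (simp add: algebra_simps)
  ultimately show "poly [:D, -a, B, A:] z < Q * z ^ 3"
    unfolding eq using assms by linarith
qed

lemma digit_eqD:
  fixes c c' x x' z :: int
  assumes "c + z * x = c' + z * x'" "0 \<le> c" "c < z" "0 \<le> c'" "c' < z"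
  shows "c = c'" "x = x'"
proof -
  have "c = (c + z * x) mod z" using assms(2,3) by simp
  also have "\<dots> = (c' + z * x') mod z" using assms(1) by simp
  also have "\<dots> = c'" using assms(4,5) by simp
  finally show c: "c = c'" .
  show "x = x'" using assms c by simp
qed

text \<open>After the borrow the value reads D, z - a, B - 1, A in base z, so the coefficients can
  be read off. B - 1 is kept together with z A because B = 0 is allowed.\<close>

lemma cubic_eqD:
  fixes A B D a A' B' D' a' z :: int
  assumes "poly [:D, -a, B, A:] z = poly [:D', -a', B', A':] z"
    and "0 \<le> B" "B < z" "0 \<le> D" "D < z" "1 \<le> a" "a \<le> z"
    and "0 \<le> B'" "B' < z" "0 \<le> D'" "D' < z" "1 \<le> a'" "a' \<le> z"
  shows "A = A' \<and> B = B' \<and> a = a' \<and> D = D'"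
proof -
  have "D + z * (z - a + z * (B + z * A - 1)) = D' + z * (z - a' + z * (B' + z * A' - 1))"
    using assms(1) by (simp add: algebra_simps)
  note 1 = digit_eqD[OF this assms(4,5,10,11)]
  have 2: "z - a = z - a'" "B + z * A - 1 = B' + z * A' - 1"
    using digit_eqD[OF 1(2)] assms by auto
  have "B + z * A = B' + z * A'" using 2(2) by simp
  from 1 2 digit_eqD[OF this assms(2,3,8,9)] show ?thesis by simp
qed

text \<open>Each quadruple (A, B, a, D) in a box \<open>V\<close> receives an exponent k in (b, b +
  m] that hits the class of g. The resulting arguments are distinct and below N, so the count is at
  least the size of the box.\<close>

lemma digit_sum_count_ge_power:
  fixes q m s u N :: nat and r :: "int poly" and g :: int
  defines "h \<equiv> degree r"
  defines "W \<equiv> h * q * (6 * q) ^ h"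
  assumes q: "q \<ge> 2" and m: "m \<ge> 1" "coprime m (q - 1)" and h: "h \<ge> 1"
    and r: "\<And>i. coeff r i \<ge> 0" and s: "(\<Sum>l\<le>h. coeff r l) \<le> int q ^ s"
    and W: "2 * W \<le> q ^ u" and N: "q ^ (u * (3 * h + 1) + 3 * (2 * h + s + m)) \<le> N"
  shows "(q ^ u) ^ 4 \<le> 16 * W * digit_sum_count q m r g N"
proof -
  have q1: "1 \<le> int q" using q by simp
  have Wpos: "W > 0" using h q by (simp add: W_def)
  have u: "u \<ge> 1"
  proof (rule ccontr)
    assume "\<not> u \<ge> 1"
    then have "u = 0" by simp
    then have "2 * W \<le> 1" using W by simp
    with Wpos show False by linarith
  qed
  define M where "M = int q ^ (u - 1)"
  define Q where "Q = int q ^ u"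
  have Mu: "int q * M = Q" unfolding M_def Q_def using u by (simp add: power_eq_if)
  have M: "M \<ge> 1" unfolding M_def using q1 by simp
  have MQ: "2 * M \<le> Q" using q M unfolding Mu[symmetric] by (intro mult_right_mono) auto
  \<comment> \<open>As Q = qM and W = q h (6q)^h, the condition a <= Q / W is exactly the smallness
    condition a h (6q)^h <= M.\<close>
  define V where "V = {M..<Q} \<times> {M..<Q} \<times> {1..Q div int W} \<times> {M..<Q}"
  define F where "F = (\<lambda>(A, B, a, D) k. poly [:D, -a, B, A:] (int q ^ k))"
  define b where "b = h * u + 2 * h + s"
  have aM: "a * (int h * (6 * int q) ^ h) \<le> M" if "a \<le> Q div int W" for a
  proof -
    have "a * int W \<le> Q div int W * int W" using that by (intro mult_right_mono) auto
    also have "\<dots> \<le> Q" using Wpos by (simp flip: minus_mod_eq_div_mult)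
    finally have "int q * (a * (int h * (6 * int q) ^ h)) \<le> int q * M"
      unfolding Mu by (simp add: W_def mult_ac)
    then show ?thesis using q by simp
  qed
  have aM': "a \<le> M" if "1 \<le> a" "a \<le> Q div int W" for a
  proof -
    have "1 * 1 \<le> int h * (6 * int q) ^ h"
      using h q1 by (intro mult_mono one_le_power) auto
    then have "a * 1 \<le> a * (int h * (6 * int q) ^ h)"
      using that by (intro mult_left_mono) auto
    with aM[OF that(2)] show ?thesis by linarith
  qed
  have "\<exists>k. b < k \<and> k \<le> b + m \<and>
      [int (digit_sum q (nat (poly r (F v k)))) = g] (mod int m)" if "v \<in> V" for v
  proof -
    obtain A B a D where v: "v = (A, B, a, D)" by (cases v)
    have "\<exists>w. \<forall>k > degree r * u + 2 * degree r + s.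
      int (digit_sum q (nat (poly r (poly [:D, -a, B, A:] (int q ^ k))))) = w + int (q - 1) * int k"
      by (rule digit_sum_poly_cubic[where M = M])
        (use that q h r s Mu aM[of a] in \<open>auto simp: V_def v h_def Q_def\<close>)
    then obtain w where w: "\<And>k. k > b \<Longrightarrow>
        int (digit_sum q (nat (poly r (F v k)))) = w + int (q - 1) * int k"
      unfolding b_def h_def F_def v by auto
    obtain j where "j \<in> {1..m}" "[w + int (q - 1) * int (b + j) = g] (mod int m)"
      using exists_cong_arith_progression[OF m] by blast
    then show ?thesis using w[of "b + j"] by (intro exI[of _ "b + j"]) auto
  qed
  then obtain K where K: "\<And>v. v \<in> V \<Longrightarrow> b < K v \<and> K v \<le> b + m \<and>
      [int (digit_sum q (nat (poly r (F v (K v))))) = g] (mod int m)" by metis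
  have Qk: "Q \<le> int q ^ k" if "b < k" for k
  proof -
    from h have "1 * u \<le> h * u" by (rule mult_le_mono1)
    then have "u \<le> k" using that unfolding b_def by linarith
    then show ?thesis unfolding Q_def using q1 by (intro power_increasing) auto
  qed
  have F_bounds: "M * int q ^ (3 * k) \<le> F v k" "F v k < M * int q ^ (3 * k + 1)"
    if "v \<in> V" "b < k" for v k
  proof -
    obtain A B a D where v: "v = (A, B, a, D)" by (cases v)
    have "a \<le> int q ^ k" "1 \<le> a" "Q \<le> int q ^ k" "M \<le> A" "A < Q" "1 \<le> B" "B < Q" "0 \<le> D" "D < Q"
      using that aM'[of a] Qk[OF that(2)] M MQ by (auto simp: V_def v)
    from cubic_bounds[OF this(4-9) this(2,1,3)]
    show "M * int q ^ (3 * k) \<le> F v k" "F v k < M * int q ^ (3 * k + 1)"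
      unfolding Mu[symmetric] by (auto simp: F_def v power_mult mult_ac simp flip: power_mult)
  qed
  have F_nonneg: "0 \<le> F v k" if "v \<in> V" "b < k" for v k
    using F_bounds(1)[OF that] M by (meson dual_order.trans mult_nonneg_nonneg zero_le_power of_nat_0_le_iff
        zero_le_one)
  \<comment> \<open>Values for exponent k lie in [M q^(3k), M q^(3k+1)). These intervals are
    disjoint for different k, so equal values force equal exponents; the coefficients are then
    compared in base q^k.\<close>
  have K_le: "K v \<le> K v'" if "v \<in> V" "v' \<in> V" "F v (K v) = F v' (K v')" for v v'
  proof (rule ccontr)
    assume "\<not> K v \<le> K v'"
    then have "int q ^ (3 * K v' + 1) \<le> int q ^ (3 * K v)"
      using q1 by (intro power_increasing) auto
    then have "M * int q ^ (3 * K v' + 1) \<le> M * int q ^ (3 * K v)"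
      using M by (intro mult_left_mono) auto
    with F_bounds(1)[OF that(1), of "K v"] F_bounds(2)[OF that(2), of "K v'"] that K
    show False by fastforce
  qed
  have "inj_on (\<lambda>v. nat (F v (K v))) V"
  proof (rule inj_onI)
    fix v v' assume vV: "v \<in> V" "v' \<in> V" and "nat (F v (K v)) = nat (F v' (K v'))"
    then have eq: "F v (K v) = F v' (K v')"
      using F_nonneg K by (simp add: eq_nat_nat_iff)
    have k: "K v' = K v" using K_le[OF vV eq] K_le[OF vV(2,1) eq[symmetric]] by simp
    obtain A B a D where v: "v = (A, B, a, D)" by (cases v)
    obtain A' B' a' D' where v': "v' = (A', B', a', D')" by (cases v')
    have "poly [:D, -a, B, A:] (int q ^ K v) = poly [:D', -a', B', A':] (int q ^ K v)"
      using eq unfolding k by (simp add: F_def v v')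
    moreover have "Q \<le> int q ^ K v" using Qk K vV by blast
    ultimately have "A = A' \<and> B = B' \<and> a = a' \<and> D = D'"
      using vV aM'[of a] aM'[of a'] M MQ
      by (intro cubic_eqD[of D a B A "int q ^ K v"]) (auto simp: V_def v v')
    then show "v = v'" by (simp add: v v')
  qed
  moreover have "(\<lambda>v. nat (F v (K v))) ` V \<subseteq>
      {n. n < N \<and> [int (digit_sum q (nat (poly r (int n)))) = g] (mod int m)}"
  proof (intro image_subsetI CollectI conjI)
    fix v assume v: "v \<in> V"
    have Fn: "F v (K v) \<ge> 0" using F_nonneg[OF v] K[OF v] by simp
    have "F v (K v) < M * int q ^ (3 * K v + 1)" using F_bounds(2)[OF v] K[OF v] by simp
    also have "\<dots> \<le> M * int q ^ (3 * (b + m) + 1)"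
      using K[OF v] q1 M by (intro mult_left_mono power_increasing) auto
    also have "\<dots> = Q * int q ^ (3 * (b + m))" unfolding Mu[symmetric] by simp
    also have "\<dots> = int (q ^ (u * (3 * h + 1) + 3 * (2 * h + s + m)))"
      unfolding Q_def of_nat_power power_add[symmetric] by (simp add: b_def algebra_simps)
    also have "\<dots> \<le> int N" using N by (simp only: of_nat_le_iff)
    finally show "nat (F v (K v)) < N" using Fn by linarith
    show "[int (digit_sum q (nat (poly r (int (nat (F v (K v))))))) = g] (mod int m)"
      using K[OF v] Fn by simp
  qed
  ultimately have "card V \<le> digit_sum_count q m r g N"
    unfolding digit_sum_count_def by (intro card_inj_on_le[where f = "\<lambda>v. nat (F v (K v))"]) auto
  moreover have "(q ^ u) ^ 4 \<le> 16 * W * card V"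
  proof -
    define c where "c = Q div int W"
    have "c \<ge> 1"
    proof -
      have "int W \<le> Q" using W by (simp add: Q_def flip: of_nat_power)
      then show ?thesis unfolding c_def using Wpos by (simp add: int_one_le_iff_zero_less pos_imp_zdiv_pos_iff)
    qed
    have "Q = c * int W + Q mod int W" unfolding c_def by simp
    moreover have "Q mod int W < int W" using Wpos by simp
    ultimately have "Q < (c + 1) * int W" unfolding distrib_right by linarith
    also have "\<dots> \<le> (2 * c) * int W" using \<open>c \<ge> 1\<close> by (intro mult_right_mono) auto
    finally have c: "Q \<le> 2 * c * int W" by simp
    \<comment> \<open>Each of the three ranges [M, Q) contains at least Q/2 integers, and rounding Q
      / W down to c >= 1 costs at most a factor 2: together 2^4 = 16.\<close>
    have "Q ^ 3 * Q \<le> (2 * (Q - M)) ^ 3 * (2 * c * int W)"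
      using MQ M c by (intro mult_mono power_mono) auto
    also have "\<dots> = 16 * int W * ((Q - M) * ((Q - M) * (c * (Q - M))))"
      by algebra
    also have "(Q - M) * ((Q - M) * (c * (Q - M))) = int (card V)"
      using MQ M \<open>c \<ge> 1\<close> by (simp add: V_def card_cartesian_product flip: c_def)
    also have "Q ^ 3 * Q = int ((q ^ u) ^ 4)" by (simp add: Q_def power3_eq_cube power4_eq_xxxx)
    finally have "int ((q ^ u) ^ 4) \<le> int (16 * W * card V)" by simp
    then show ?thesis by (simp only: of_nat_le_iff)
  qed
  ultimately show ?thesis by (meson le_trans mult_le_mono2)
qed

section \<open>Choice of u and the explicit constants\<close>

lemma digit_sum_count_ge_powr:
  fixes q m s N :: nat and r :: "int poly" and g :: int
  defines "h \<equiv> degree r"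
  assumes q: "q \<ge> 2" and m: "m \<ge> 1" "coprime m (q - 1)" and h: "h \<ge> 1"
    and r: "\<And>i. coeff r i \<ge> 0" and s: "(\<Sum>l\<le>h. coeff r l) \<le> int q ^ s"
    and N: "q ^ (3 * (2 * h + s + m)) * (2 * h * q ^ 2 * (6 * q) ^ h) ^ (3 * h + 1) \<le> N"
  shows "inverse (16 * real h * real q ^ 5 * (6 * real q) ^ h
      * real q powr (12 * (2 * real h + real s + real m) / (3 * real h + 1)))
      * real N powr (4 / (3 * real h + 1)) \<le> real (digit_sum_count q m r g N)"
proof -
  define W where "W = h * q * (6 * q) ^ h"
  define L where "L = 3 * (2 * h + s + m)"
  define e where "e = 3 * h + 1"
  have Wpos: "W > 0" using h q by (simp add: W_def)
  have N': "q ^ L * (q * (2 * W)) ^ e \<le> N"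
    using N by (simp add: W_def L_def e_def power2_eq_square mult_ac)
  have "1 * 1 \<le> 1 * (q * (2 * W)) ^ e"
    using q Wpos by (intro mult_le_mono one_le_power) (auto simp: Suc_le_eq)
  then have "q ^ L * 1 \<le> q ^ L * (q * (2 * W)) ^ e" by (intro mult_le_mono2) simp
  then have "q ^ L * 1 \<le> N" using N' by (rule le_trans)
  then have P0: "q ^ (0 * e + L) \<le> N" by simp
  have bound: "u \<le> N" if "q ^ (u * e + L) \<le> N" for u
  proof -
    have "u < 2 ^ u" by (rule less_exp)
    also have "\<dots> \<le> q ^ u" using q by (intro power_mono) auto
    also have "\<dots> \<le> q ^ (u * e + L)" using q by (intro power_increasing) (auto simp: e_def)
    finally show ?thesis using that by simp
  qed
  \<comment> \<open>The largest scale whose arguments still fit below N; \<open>P0\<close> shows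
    that u = 0 qualifies and \<open>bound\<close> that the candidates are bounded.\<close>
  define u where "u = (GREATEST u. q ^ (u * e + L) \<le> N)"
  have u: "q ^ (u * e + L) \<le> N"
    unfolding u_def by (rule GreatestI_nat[where P = "\<lambda>u. q ^ (u * e + L) \<le> N", OF P0 bound])
  have u': "N < q ^ (Suc u * e + L)"
  proof (rule ccontr)
    assume "\<not> ?thesis"
    then have "q ^ (Suc u * e + L) \<le> N" by (simp only: not_less)
    then have "Suc u \<le> u"
      unfolding u_def by (rule Greatest_le_nat[where P = "\<lambda>u. q ^ (u * e + L) \<le> N", OF _ bound])
    then show False by simp
  qed
  \<comment> \<open>Maximality of u against the lower bound on N yields 2 q W < q^(u+1), hence the
    requirement 2W <= q^u. The base 2 h q^2 (6q)^h in the threshold is just 2 q W.\<close>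
  have "q ^ L * (q * (2 * W)) ^ e < q ^ (Suc u * e + L)" using N' u' by (rule le_less_trans)
  also have "\<dots> = q ^ L * (q ^ Suc u) ^ e"
    unfolding power_mult[symmetric] power_add[symmetric] by (simp only: add.commute)
  finally have "(q * (2 * W)) ^ e < (q ^ Suc u) ^ e" by (simp only: nat_mult_less_cancel1 mult_less_cancel1)
  then have "q * (2 * W) < q ^ Suc u" by (rule power_less_imp_less_base) simp
  then have Wu: "2 * W \<le> q ^ u" by simp
  have "(q ^ u) ^ 4 \<le> 16 * W * digit_sum_count q m r g N"
    unfolding W_def h_def
    by (rule digit_sum_count_ge_power)
      (use assms Wu u in \<open>simp_all add: W_def h_def L_def e_def\<close>)
  then have "real ((q ^ u) ^ 4) \<le> real (16 * W * digit_sum_count q m r g N)"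
    by (simp only: of_nat_le_iff)
  then have count: "(real q ^ u) ^ 4 \<le> 16 * real W * real (digit_sum_count q m r g N)" by simp
  define X where "X = real q powr (12 * (2 * real h + real s + real m) / (3 * real h + 1))"
  have q0: "real q > 0" using q by simp
  have X: "X > 0" unfolding X_def using q0 by simp
  \<comment> \<open>Since N < q^((u+1)e + L), the power 4/e of N is at most q^(4u+4) X. The extra
    q^4, the price of rounding u down, joins the factor q in W to give q^5.\<close>
  have "real N powr (4 / (3 * real h + 1)) \<le> (real q ^ (Suc u * e + L)) powr (4 / (3 * real h + 1))"
    using u' by (intro powr_mono2) (auto simp flip: of_nat_power simp del: power_Suc)
  also have "\<dots> = real q powr (real (Suc u * e + L) * (4 / (3 * real h + 1)))"
    using q0 by (simp only: powr_powr powr_realpow[symmetric])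
  also have "real (Suc u * e + L) * (4 / (3 * real h + 1)) =
      real (4 * u + 4) + 12 * (2 * real h + real s + real m) / (3 * real h + 1)"
  proof -
    define E where "E = 3 * real h + 1"
    have "real (Suc u * e + L) = (real u + 1) * E + 3 * (2 * real h + real s + real m)"
      by (simp add: e_def L_def E_def algebra_simps)
    moreover have "E \<noteq> 0" by (simp add: E_def add_nonneg_eq_0_iff)
    ultimately show ?thesis unfolding E_def[symmetric] by (simp add: field_simps)
  qed
  also have "real q powr \<dots> = real q ^ (4 * u + 4) * X"
    unfolding powr_add X_def powr_realpow[OF q0] ..
  also have "real q ^ (4 * u + 4) = (real q ^ u) ^ 4 * real q ^ 4"
    by (simp add: power_add power_mult[symmetric] mult.commute)
  finally have "real N powr (4 / (3 * real h + 1)) \<le> (real q ^ u) ^ 4 * (real q ^ 4 * X)"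
    by (simp only: mult.assoc)
  also have "\<dots> \<le> (16 * real W * real (digit_sum_count q m r g N)) * (real q ^ 4 * X)"
    using count X by (intro mult_right_mono) auto
  also have "\<dots> = real (digit_sum_count q m r g N) * (16 * real h * real q ^ 5 * (6 * real q) ^ h * X)"
    using power_Suc[of "real q" 4] by (simp add: W_def mult_ac del: power_Suc)
  finally have le: "real N powr (4 / (3 * real h + 1)) \<le>
      real (digit_sum_count q m r g N) * (16 * real h * real q ^ 5 * (6 * real q) ^ h * X)" .
  have "16 * real h * real q ^ 5 * (6 * real q) ^ h * X > 0"
    using X q0 h by (intro mult_pos_pos) auto
  then show ?thesis
    using le unfolding X_def[symmetric] by (simp add: field_simps)
qed

section \<open>Reduction of general polynomials to nonnegative coefficients\<close>

lemma lead_coeff_pos_if_nonneg_on_Nats: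
  fixes p :: "int poly"
  assumes "p \<noteq> 0" "\<And>n::nat. poly p (int n) \<ge> 0"
  shows "lead_coeff p > 0"
proof (rule ccontr)
  assume "\<not> lead_coeff p > 0"
  then have "lead_coeff (- p) > 0" using assms(1) by (simp add: not_less le_less)
  then obtain e0 where "poly (- p) (int e0) > 0"
    using shifted_poly_nonneg_coeffs[of "- p"] by blast
  then show False using assms(2)[of e0] by simp
qed

lemma digit_sum_count_shift_le:
  "digit_sum_count q m (p \<circ>\<^sub>p [:int e, 1:]) g N \<le> digit_sum_count q m p g (N + e)"
  unfolding digit_sum_count_def
  by (rule card_inj_on_le[where f = "\<lambda>n. n + e"]) (auto simp: poly_pcompose add.commute)

theorem theorem1p4:
  fixes q m h :: nat and p :: "int poly"
  assumes "q \<ge> 2" and "m \<ge> 2" and "gcd m (q - 1) = 1"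
    and "degree p = h" and "h \<ge> 3"
    and "poly p ` \<nat> \<subseteq> \<nat>"
  shows "(\<exists>C::real. \<exists>N0::nat. C > 0 \<and> N0 \<ge> 1 \<and>
            (\<forall>g::int. \<forall>N\<ge>N0.
               real (digit_sum_count q m p g N) \<ge> C * real N powr (4 / (3 * real h + 1))))
       \<and> (p = monom 1 h \<longrightarrow>
            (let N0 = q ^ (3 * (2 * h + m)) * (2 * h * q ^ 2 * (6 * q) ^ h) ^ (3 * h + 1);
                 C = inverse (16 * real h * real q ^ 5 * (6 * real q) ^ h
                       * real q powr ((24 * real h + 12 * real m) / (3 * real h + 1)))
             in \<forall>g::int. \<forall>N\<ge>N0.
                  real (digit_sum_count q m p g N) \<ge> C * real N powr (4 / (3 * real h + 1))))"
proof (intro conjI impI)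
  have m: "m \<ge> 1" "coprime m (q - 1)" using assms(2,3) by (simp_all add: coprime_iff_gcd_eq_1)
  have h: "degree p \<ge> 1" using assms(4,5) by simp
  {
    have nonneg: "poly p (int n) \<ge> 0" for n
    proof -
      have "poly p (int n) \<in> \<nat>" using assms(6) by (auto simp: of_nat_in_Nats)
      then show ?thesis by (auto elim: Nats_cases)
    qed
    have "p \<noteq> 0" using h by auto
    then obtain e where e: "\<And>i. coeff (p \<circ>\<^sub>p [:int e, 1:]) i \<ge> 0"
      using shifted_poly_nonneg_coeffs lead_coeff_pos_if_nonneg_on_Nats nonneg by blast
    define r where "r = p \<circ>\<^sub>p [:int e, 1:]"
    have deg: "degree r = h" using assms(4) by (simp add: r_def degree_pcompose)
    \<comment> \<open>The coefficient sum itself serves as exponent, because s < 2^s <= q^s.\<close>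
    define s where "s = nat (\<Sum>l\<le>h. coeff r l)"
    have "s < 2 ^ s" by (rule less_exp)
    also have "(2::nat) ^ s \<le> q ^ s" using assms(1) by (intro power_mono) auto
    finally have "int s \<le> int q ^ s" by (simp flip: of_nat_power)
    then have s: "(\<Sum>l\<le>h. coeff r l) \<le> int q ^ s" unfolding s_def by linarith
    define N1 where "N1 = q ^ (3 * (2 * h + s + m)) * (2 * h * q ^ 2 * (6 * q) ^ h) ^ (3 * h + 1)"
    define \<alpha> where "\<alpha> = 4 / (3 * real h + 1)"
    define C where "C = inverse (16 * real h * real q ^ 5 * (6 * real q) ^ h
      * real q powr (12 * (2 * real h + real s + real m) / (3 * real h + 1)))"
    have C: "C > 0" unfolding C_def using assms(1,5) by (intro positive_imp_inverse_positive mult_pos_pos) auto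
    \<comment> \<open>The translate is counted up to N - e. The threshold gives N - e >= N1 and N -
      e >= N/2, the latter at the cost of a factor (1/2)^\<alpha> in the constant.\<close>
    have "C * (1/2) powr \<alpha> * real N powr \<alpha> \<le> real (digit_sum_count q m p g N)"
      if N: "N \<ge> N1 + 2 * e + 1" for g N
    proof -
      have "C * (1/2) powr \<alpha> * real N powr \<alpha> = C * (real N / 2) powr \<alpha>"
        by (simp add: powr_divide)
      also have "\<dots> \<le> C * real (N - e) powr \<alpha>"
        using C N by (intro mult_left_mono powr_mono2) (auto simp: \<alpha>_def of_nat_diff)
      also have "\<dots> \<le> real (digit_sum_count q m r g (N - e))"
        using digit_sum_count_ge_powr[OF assms(1) m, of r s "N - e" g] e s N assms(5)
        unfolding deg C_def \<alpha>_def N1_def r_def[symmetric] by simp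
      also have "\<dots> \<le> real (digit_sum_count q m p g N)"
        using digit_sum_count_shift_le[of q m p e g "N - e"] N by (simp add: r_def)
      finally show ?thesis .
    qed
    moreover have "C * (1/2) powr \<alpha> > 0" using C by simp
    ultimately show "\<exists>C::real. \<exists>N0::nat. C > 0 \<and> N0 \<ge> 1 \<and>
        (\<forall>g::int. \<forall>N\<ge>N0.
           real (digit_sum_count q m p g N) \<ge> C * real N powr (4 / (3 * real h + 1)))"
      unfolding \<alpha>_def by (intro exI[of _ "C * (1/2) powr (4 / (3 * real h + 1))"] exI[of _ "N1 + 2 * e + 1"]) auto
  }
  assume p: "p = monom 1 h"
  \<comment> \<open>For a monomial no translation is made, and the coefficient sum is 1 = q^0, so s
    = 0 gives the stated constants.\<close>
  have "(\<Sum>l\<le>degree p. coeff p l) \<le> int q ^ 0"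
    by (simp add: p degree_monom_eq)
  moreover have "coeff p i \<ge> 0" for i by (simp add: p)
  moreover have "12 * (2 * real h + real 0 + real m) = 24 * real h + 12 * real m" by simp
  ultimately show "let N0 = q ^ (3 * (2 * h + m)) * (2 * h * q ^ 2 * (6 * q) ^ h) ^ (3 * h + 1);
                 C = inverse (16 * real h * real q ^ 5 * (6 * real q) ^ h
                       * real q powr ((24 * real h + 12 * real m) / (3 * real h + 1)))
             in \<forall>g::int. \<forall>N\<ge>N0.
                  real (digit_sum_count q m p g N) \<ge> C * real N powr (4 / (3 * real h + 1))"
    using digit_sum_count_ge_powr[OF assms(1) m h, of 0] unfolding assms(4) Let_def add_0_right by metis
qed

end
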